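(* Let $T=(T_{i,j,k})_{i,j,k\in\mathbb Z}$ be an ergodic measure preserving $\mathbb Z^3$-action on a probability space $(\Omega,\mathcal A,\mu)$. Let $\mathcal I_1,\mathcal I_2,\mathcal I_3$ be the $\sigma$-algebras of sets in $\mathcal A$ invariant under $T_{1,0,0}$, $T_{0,1,0}$, $T_{0,0,1}$ respectively, and put $$\overline{\mathcal I}_1=\mathcal I_2\cap\mathcal I_3,\qquad \overline{\mathcal I}_2=\mathcal I_1\cap\mathcal I_3,\qquad \overline{\mathcal I}_3=\mathcal I_1\cap\mathcal I_2 .$$ Then the $\sigma$-algebras $\overline{\mathcal I}_1,\overline{\mathcal I}_2,\overline{\mathcal I}_3$ are (mutually) independent.
   Context: A measure preserving $\mathbb Z^3$-action is a family of bimeasurable $\mu$-preserving bijections $T_{i,j,k}$ of $\Omega$ with $T_{i,j,k}\circ T_{i',j',k'}=T_{i+i',j+j',k+k'}$ and $T_{0,0,0}=\mathrm{id}$; it is ergodic if every set in $\mathcal A$ invariant under all $T_{i,j,k}$ has measure $0$ or $1$. *)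

theory Defs
  imports "HOL-Probability.Probability"
begin

definition mp_bijection :: "'a measure \<Rightarrow> ('a \<Rightarrow> 'a) \<Rightarrow> bool" where
  "mp_bijection M f \<longleftrightarrow>
     bij_betw f (space M) (space M) \<and>
     f \<in> measurable M M \<and>
     inv_into (space M) f \<in> measurable M M \<and>
     (\<forall>A\<in>sets M. emeasure M (f -` A \<inter> space M) = emeasure M A)"

definition mp_Z3_action :: "'a measure \<Rightarrow> (int \<Rightarrow> int \<Rightarrow> int \<Rightarrow> 'a \<Rightarrow> 'a) \<Rightarrow> bool" where
  "mp_Z3_action M T \<longleftrightarrow>
     (\<forall>i j k. mp_bijection M (T i j k)) \<and>
     (\<forall>i j k i' j' k'. \<forall>x\<in>space M. T i j k (T i' j' k' x) = T (i + i') (j + j') (k + k') x) \<and>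
     (\<forall>x\<in>space M. T 0 0 0 x = x)"

text \<open>Invariance is strict: the preimage is equal to the set, not merely up to a null set.\<close>

definition invariant_sets :: "'a measure \<Rightarrow> ('a \<Rightarrow> 'a) \<Rightarrow> 'a set set" where
  "invariant_sets M f = {A \<in> sets M. f -` A \<inter> space M = A}"

lemma sigma_algebra_invariant_sets:
  assumes "f \<in> measurable M M"
  shows "sigma_algebra (space M) (invariant_sets M f)"
proof -
  have "f x \<in> space M" if "x \<in> space M" for x
    using assms that by (rule measurable_space)
  moreover have "A \<subseteq> space M" if "A \<in> sets M" for A
    using that by (rule sets.sets_into_space)
  ultimately show ?thesis
    unfolding sigma_algebra_iff2 invariant_sets_def by (fastforce simp: vimage_UN)
qed

definition ergodic_Z3_action :: "'a measure \<Rightarrow> (int \<Rightarrow> int \<Rightarrow> int \<Rightarrow> 'a \<Rightarrow> 'a) \<Rightarrow> bool" where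
  "ergodic_Z3_action M T \<longleftrightarrow>
     mp_Z3_action M T \<and>
     (\<forall>A\<in>sets M. (\<forall>i j k. A \<in> invariant_sets M (T i j k)) \<longrightarrow>
        emeasure M A = 0 \<or> emeasure M A = 1)"

end

theory Submission
  imports Defs
begin

text \<open>
  The conditional expectation of the indicator of $A \in \mathcal I_2 \cap \mathcal I_3$ given
  $\mathcal I_1$ is invariant under $T_{1,0,0}$ by measurability, and almost everywhere invariant
  under $T_{0,j,k}$ because these maps fix $A$ and commute with $T_{1,0,0}$. By ergodicity it is
  constant, so $A$ is independent of $\mathcal I_1$, which contains $B \cap C$ for
  $B \in \overline{\mathcal I}_2$ and $C \in \overline{\mathcal I}_3$. In the same way $B$ is
  independent of $C \in \mathcal I_2$.
\<close>

section \<open>Strictly invariant sets as a sigma-algebra\<close>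

lemma invariant_sets_iff:
  "A \<in> invariant_sets M f \<longleftrightarrow> A \<in> sets M \<and> (\<forall>x\<in>space M. f x \<in> A \<longleftrightarrow> x \<in> A)"
  unfolding invariant_sets_def using sets.sets_into_space by fastforce

text \<open>Conditional expectations take a sigma-algebra in the form of a measure; only the space
  and the sets of this one matter.\<close>

definition invariant_algebra :: "'a measure \<Rightarrow> ('a \<Rightarrow> 'a) \<Rightarrow> 'a measure" where
  "invariant_algebra M f = sigma (space M) (invariant_sets M f)"

lemma space_invariant_algebra [simp]: "space (invariant_algebra M f) = space M"
  by (simp add: invariant_algebra_def space_measure_of_conv)

lemma sets_invariant_algebra:
  assumes "f \<in> measurable M M"
  shows "sets (invariant_algebra M f) = invariant_sets M f"
  unfolding invariant_algebra_def
  by (rule sigma_algebra.sets_measure_of_eq[OF sigma_algebra_invariant_sets[OF assms]])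

lemma subalgebra_invariant_algebra:
  assumes "f \<in> measurable M M"
  shows "subalgebra M (invariant_algebra M f)"
  by (auto simp: subalgebra_def sets_invariant_algebra[OF assms] invariant_sets_iff)

text \<open>The level set of \<open>X\<close> through \<open>x\<close> is strictly invariant and
  contains \<open>x\<close>, hence also \<open>f x\<close>. The equality therefore holds at every
  point, not just almost everywhere.\<close>

lemma invariant_algebra_measurable_invariant:
  fixes X :: "'a \<Rightarrow> real"
  assumes f: "f \<in> measurable M M" and X: "X \<in> borel_measurable (invariant_algebra M f)"
    and x: "x \<in> space M"
  shows "X (f x) = X x"
proof -
  have "X -` {X x} \<inter> space M \<in> invariant_sets M f"
    using measurable_sets[OF X, of "{X x}"] by (simp add: sets_invariant_algebra[OF f])
  then show ?thesis
    using x measurable_space[OF f x] by (auto simp: invariant_sets_iff)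
qed

section \<open>Measure preserving bijections and conditional expectation\<close>

lemma mp_bijectionD:
  assumes "mp_bijection M g"
  shows "g \<in> measurable M M" "inv_into (space M) g \<in> measurable M M" "distr M M g = M"
    and "\<And>x. x \<in> space M \<Longrightarrow> inv_into (space M) g (g x) = x"
    and "\<And>x. x \<in> space M \<Longrightarrow> g (inv_into (space M) g x) = x"
proof -
  show "g \<in> measurable M M" "inv_into (space M) g \<in> measurable M M"
    using assms by (auto simp: mp_bijection_def)
  then show "distr M M g = M"
    using assms by (intro measure_eqI) (auto simp: mp_bijection_def emeasure_distr)
  show "inv_into (space M) g (g x) = x" if "x \<in> space M" for x
    using assms that by (auto simp: mp_bijection_def intro: bij_betw_inv_into_left)
  show "g (inv_into (space M) g x) = x" if "x \<in> space M" for x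
    using assms that by (auto simp: mp_bijection_def intro: bij_betw_inv_into_right)
qed

text \<open>If \<open>D\<close> is \<open>f\<close>-invariant, then \<open>g (f x) = f (g x)\<close>
  lies in \<open>D\<close> exactly when \<open>g x\<close> does, so the preimage of \<open>D\<close>
  under \<open>g\<close> is \<open>f\<close>-invariant too.\<close>

lemma measurable_invariant_algebra_commuting:
  assumes f: "f \<in> measurable M M" and g: "g \<in> measurable M M"
    and comm: "\<And>x. x \<in> space M \<Longrightarrow> f (g x) = g (f x)"
  shows "g \<in> measurable (invariant_algebra M f) (invariant_algebra M f)"
proof (rule measurableI)
  show "g x \<in> space (invariant_algebra M f)" if "x \<in> space (invariant_algebra M f)" for x
    using that measurable_space[OF g] by simp
next
  fix D assume "D \<in> sets (invariant_algebra M f)"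
  then have "D \<in> sets M" and D: "\<And>x. x \<in> space M \<Longrightarrow> f x \<in> D \<longleftrightarrow> x \<in> D"
    by (auto simp: sets_invariant_algebra[OF f] invariant_sets_iff)
  moreover have "g (f x) \<in> D \<longleftrightarrow> g x \<in> D" if "x \<in> space M" for x
    using D[of "g x"] comm[OF that] measurable_space[OF g that] by simp
  ultimately show "g -` D \<inter> space (invariant_algebra M f) \<in> sets (invariant_algebra M f)"
    using measurable_sets[OF g] measurable_space[OF f]
    by (auto simp: sets_invariant_algebra[OF f] invariant_sets_iff)
qed

text \<open>The function \<open>X\<close> composed with \<open>g\<close> is measurable for the
  \<open>f\<close>-invariant sets and has the integrals over them that characterise the conditional
  expectation of \<open>A\<close>; uniqueness up to null sets then gives the claim.\<close>

lemma (in prob_space) AE_real_cond_exp_commuting: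
  assumes f: "f \<in> measurable M M" and g: "mp_bijection M g"
    and comm: "\<And>x. x \<in> space M \<Longrightarrow> f (g x) = g (f x)"
    and A: "A \<in> invariant_sets M g"
  defines "X \<equiv> real_cond_exp M (invariant_algebra M f) (indicator A)"
  shows "AE x in M. X (g x) = X x"
proof -
  let ?F = "invariant_algebra M f"
  interpret finite_measure_subalgebra M ?F
    by unfold_locales (rule subalgebra_invariant_algebra[OF f])
  note gD = mp_bijectionD[OF g]
  let ?h = "inv_into (space M) g"
  have A_sets: "A \<in> sets M" and A_iff: "\<And>x. x \<in> space M \<Longrightarrow> g x \<in> A \<longleftrightarrow> x \<in> A"
    using A by (auto simp: invariant_sets_iff)
  have int_A: "integrable M (indicator A :: 'a \<Rightarrow> real)"
    using A_sets by (simp add: emeasure_eq_measure)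
  have int_X: "integrable M X"
    unfolding X_def by (rule real_cond_exp_int(1)[OF int_A])
  have X_F: "X \<in> borel_measurable ?F"
    unfolding X_def by simp
  \<comment> \<open>The inverse must commute with \<open>f\<close> as well, because images of
    \<open>f\<close>-invariant sets under \<open>g\<close> are handled below as preimages under
    \<open>?h\<close>.\<close>
  have comm_h: "f (?h x) = ?h (f x)" if x: "x \<in> space M" for x
  proof -
    have hx: "?h x \<in> space M"
      using measurable_space[OF gD(2) x] .
    have "g (f (?h x)) = f x"
      using comm[OF hx] gD(5)[OF x] by simp
    then show ?thesis
      using gD(4)[OF measurable_space[OF f hx]] by simp
  qed
  have h_F: "?h \<in> measurable ?F ?F"
    by (rule measurable_invariant_algebra_commuting[OF f gD(2) comm_h])
  have g_F: "g \<in> measurable ?F ?F"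
    by (rule measurable_invariant_algebra_commuting[OF f gD(1) comm])
  have int_comp: "(\<integral>x. u (g x) \<partial>M) = (\<integral>x. u x \<partial>M)" if "u \<in> borel_measurable M" for u :: "'a \<Rightarrow> real"
    using integral_distr[OF gD(1) that] by (simp add: gD(3))
  have "AE x in M. real_cond_exp M ?F (indicator A) x = X (g x)"
  proof (rule real_cond_exp_charact)
    fix D assume D: "D \<in> sets ?F"
    \<comment> \<open>This is the image of \<open>D\<close> under \<open>g\<close>.\<close>
    let ?D' = "?h -` D \<inter> space M"
    have D': "?D' \<in> sets ?F"
      using measurable_sets[OF h_F D] by simp
    have D'_M: "?D' \<in> sets M"
      using D' subalg by (auto simp: subalgebra_def)
    have D'_iff: "g x \<in> ?D' \<longleftrightarrow> x \<in> D" if "x \<in> space M" for x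
      using that gD(4) measurable_space[OF gD(1)] by auto
    have X_M: "X \<in> borel_measurable M"
      using int_X by simp
    have D'_ind: "indicat_real ?D' (g x) = indicator D x" if "x \<in> space M" for x
      using D'_iff[OF that] unfolding indicator_def by presburger
    \<comment> \<open>Both indicators factor through \<open>g\<close>: that of \<open>D\<close> is
      that of \<open>?D'\<close> after \<open>g\<close>, and that of \<open>A\<close> is its own
      composite with \<open>g\<close>. The integral thus moves to \<open>?D'\<close>, where
      \<open>A\<close> can be replaced by \<open>X\<close>, and then back to
      \<open>D\<close>.\<close>
    have "(\<integral>x\<in>D. indicat_real A x \<partial>M) = (\<integral>x. indicator ?D' (g x) * indicator A (g x) \<partial>M)"
      unfolding set_lebesgue_integral_def
      by (rule Bochner_Integration.integral_cong[OF refl]) (simp only: D'_ind, simp add: A_iff indicator_def)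
    also have "\<dots> = (\<integral>x\<in>?D'. indicator A x \<partial>M)"
      using int_comp[of "\<lambda>x. indicator ?D' x * indicator A x"] D'_M A_sets
      by (simp add: set_lebesgue_integral_def)
    also have "\<dots> = (\<integral>x\<in>?D'. X x \<partial>M)"
      unfolding X_def by (rule real_cond_exp_intA[OF int_A D'])
    also have "\<dots> = (\<integral>x. indicator ?D' (g x) * X (g x) \<partial>M)"
      using int_comp[of "\<lambda>x. indicator ?D' x * X x"] D'_M X_M
      by (simp add: set_lebesgue_integral_def)
    also have "\<dots> = (\<integral>x\<in>D. X (g x) \<partial>M)"
      unfolding set_lebesgue_integral_def
      by (rule Bochner_Integration.integral_cong[OF refl]) (simp only: D'_ind real_scaleR_def)
    finally show "(\<integral>x\<in>D. indicat_real A x \<partial>M) = (\<integral>x\<in>D. X (g x) \<partial>M)" .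
  next
    show "integrable M (\<lambda>x. X (g x))"
      using integrable_distr[OF gD(1), of X] int_X by (simp add: gD(3))
    show "(\<lambda>x. X (g x)) \<in> borel_measurable ?F"
      using measurable_compose[OF g_F X_F] .
  qed (rule int_A)
  then show ?thesis
    by (auto simp: X_def)
qed

section \<open>From generators to the whole action\<close>

text \<open>Induction from 0 in both directions; the downward step is the identity
  \<open>step\<close> read backwards at \<open>i - 1\<close>. The codomain of \<open>\<phi>\<close>
  is arbitrary so that both real functions and membership predicates are covered.\<close>

lemma int_action_invariant:
  fixes S :: "int \<Rightarrow> 'a \<Rightarrow> 'a" and \<phi> :: "'a \<Rightarrow> 'b"
  assumes maps: "\<And>n x. x \<in> \<Omega> \<Longrightarrow> S n x \<in> \<Omega>"
    and add: "\<And>m n x. x \<in> \<Omega> \<Longrightarrow> S m (S n x) = S (m + n) x"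
    and zero: "\<And>x. x \<in> \<Omega> \<Longrightarrow> S 0 x = x"
    and one: "\<And>x. x \<in> \<Omega> \<Longrightarrow> \<phi> (S 1 x) = \<phi> x"
    and x: "x \<in> \<Omega>"
  shows "\<phi> (S n x) = \<phi> x"
proof -
  have step: "\<phi> (S (n + 1) x) = \<phi> (S n x)" for n
    using one[OF maps[OF x], of n] add[OF x, of 1 n] by (simp add: add.commute)
  show ?thesis
  proof (induction n rule: int_induct[where k = 0])
    case base
    then show ?case using zero[OF x] by simp
  next
    case (step1 i)
    then show ?case using step[of i] by simp
  next
    case (step2 i)
    then show ?case using step[of "i - 1"] by simp
  qed
qed

lemma mp_Z3_actionD:
  assumes "mp_Z3_action M T"
  shows "mp_bijection M (T i j k)"
    and "x \<in> space M \<Longrightarrow> T i j k (T i' j' k' x) = T (i + i') (j + j') (k + k') x"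
    and "x \<in> space M \<Longrightarrow> T 0 0 0 x = x"
    and "T i j k \<in> measurable M M"
    and "x \<in> space M \<Longrightarrow> T i j k x \<in> space M"
proof -
  show "mp_bijection M (T i j k)"
    and "x \<in> space M \<Longrightarrow> T i j k (T i' j' k' x) = T (i + i') (j + j') (k + k') x"
    and "x \<in> space M \<Longrightarrow> T 0 0 0 x = x"
    using assms by (simp_all add: mp_Z3_action_def)
  then show m: "T i j k \<in> measurable M M"
    by (simp add: mp_bijectionD(1))
  show "x \<in> space M \<Longrightarrow> T i j k x \<in> space M"
    by (rule measurable_space[OF m])
qed

lemma mp_Z3_action_invariant:
  assumes T: "mp_Z3_action M T" and x: "x \<in> space M"
  shows "(\<And>y. y \<in> space M \<Longrightarrow> \<phi> (T 1 0 0 y) = \<phi> y) \<Longrightarrow> \<phi> (T i 0 0 x) = \<phi> x"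
    and "(\<And>y. y \<in> space M \<Longrightarrow> \<phi> (T 0 1 0 y) = \<phi> y) \<Longrightarrow> \<phi> (T 0 j 0 x) = \<phi> x"
    and "(\<And>y. y \<in> space M \<Longrightarrow> \<phi> (T 0 0 1 y) = \<phi> y) \<Longrightarrow> \<phi> (T 0 0 k x) = \<phi> x"
  by (rule int_action_invariant[of "space M" "\<lambda>n. T n 0 0"]
           int_action_invariant[of "space M" "\<lambda>n. T 0 n 0"]
           int_action_invariant[of "space M" "\<lambda>n. T 0 0 n"];
      simp add: mp_Z3_actionD[OF T] x)+

section \<open>Ergodicity and almost everywhere invariant functions\<close>

text \<open>One threshold suffices, namely the mean \<open>?c\<close>. The event that
  \<open>X\<close> exceeds \<open>?c\<close> has probability 0 or 1. Probability 1 would push the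
  mean above itself; with probability 0, \<open>?c - X x\<close> is almost everywhere nonnegative
  with integral 0, hence vanishes almost everywhere.\<close>

lemma (in prob_space) ergodic_AE_constant:
  fixes X :: "'a \<Rightarrow> real"
  assumes erg: "ergodic_Z3_action M T" and X: "integrable M X"
    and inv: "\<And>i j k. AE x in M. X (T i j k x) = X x"
  shows "AE x in M. X x = expectation X"
proof -
  have T: "mp_Z3_action M T"
    using erg by (simp add: ergodic_Z3_action_def)
  note T_meas [measurable] = mp_Z3_actionD(4)[OF T]
  have X_meas [measurable]: "X \<in> borel_measurable M"
    using X by simp
  let ?c = "expectation X"
  \<comment> \<open>The orbitwise version of \<open>{x. X x > c}\<close> is strictly invariant, as ergodicity requires.\<close>
  define E where "E = {x \<in> space M. \<forall>i j k. X (T i j k x) > ?c}"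
  have E_sets: "E \<in> sets M"
    unfolding E_def by measurable
  \<comment> \<open>The index set is countable, so the exceptional null sets combine into
    one.\<close>
  have "AE x in M. \<forall>i j k. X (T i j k x) = X x"
    using inv by (simp add: AE_all_countable)
  then have AE_E: "AE x in M. x \<in> E \<longleftrightarrow> X x > ?c"
    by (rule AE_mp) (auto simp: E_def intro!: AE_I2)
  have "E \<in> invariant_sets M (T i j k)" for i j k
  proof -
    have "T i j k x \<in> E \<longleftrightarrow> x \<in> E" if x: "x \<in> space M" for x
    proof
      assume "x \<in> E"
      then show "T i j k x \<in> E"
        using x by (simp add: E_def mp_Z3_actionD[OF T])
    next
      assume "T i j k x \<in> E"
      then have *: "X (T a b c (T i j k x)) > ?c" for a b c
        by (simp add: E_def)
      \<comment> \<open>Shifting the indices by \<open>i\<close>, \<open>j\<close>, \<open>k\<close>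
        undoes the map applied to \<open>x\<close>.\<close>
      have "X (T a b c x) > ?c" for a b c
        using *[of "a - i" "b - j" "c - k"] x by (simp add: mp_Z3_actionD(2)[OF T])
      then show "x \<in> E"
        using x by (simp add: E_def)
    qed
    then show ?thesis
      using E_sets by (simp add: invariant_sets_iff)
  qed
  then have "emeasure M E = 0 \<or> emeasure M E = 1"
    using erg E_sets by (simp add: ergodic_Z3_action_def)
  then show ?thesis
  proof
    assume "emeasure M E = 0"
    then have "AE x in M. x \<notin> E"
      using E_sets by (simp add: AE_iff_null_sets[symmetric] null_sets_def)
    with AE_E have nonneg: "AE x in M. 0 \<le> ?c - X x"
      by eventually_elim auto
    have "(\<integral>x. ?c - X x \<partial>M) = 0"
      using X by (simp add: prob_space)
    then have "AE x in M. ?c - X x = 0"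
      using integral_nonneg_eq_0_iff_AE[OF _ nonneg] X by simp
    then show ?thesis
      by eventually_elim simp
  next
    assume "emeasure M E = 1"
    then have "AE x in M. x \<in> E"
      using E_sets by (simp add: AE_in_set_eq_1 emeasure_eq_measure)
    with AE_E have "AE x in M. ?c < X x"
      by eventually_elim auto
    then have "?c < expectation X"
      by (rule expectation_greater[OF X])
    then show ?thesis by simp
  qed
qed

section \<open>Independence\<close>

text \<open>The set \<open>D\<close> ranges over everything invariant under \<open>T 1 0 0\<close>,
  so that it can later be an intersection of two events.\<close>

lemma (in prob_space) prob_Int_invariant_sets:
  assumes erg: "ergodic_Z3_action M T"
    and A: "A \<in> invariant_sets M (T 0 1 0)" "A \<in> invariant_sets M (T 0 0 1)"
    and D: "D \<in> invariant_sets M (T 1 0 0)"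
  shows "prob (A \<inter> D) = prob A * prob D"
proof -
  have T: "mp_Z3_action M T"
    using erg by (simp add: ergodic_Z3_action_def)
  note TD = mp_Z3_actionD[OF T]
  let ?F = "invariant_algebra M (T 1 0 0)"
  interpret finite_measure_subalgebra M ?F
    by unfold_locales (rule subalgebra_invariant_algebra[OF TD(4)])
  define X where "X = real_cond_exp M ?F (indicator A)"
  have A_sets: "A \<in> sets M" and D_sets: "D \<in> sets M"
    using A D by (auto simp: invariant_sets_iff)
  have int_A: "integrable M (indicator A :: 'a \<Rightarrow> real)"
    using A_sets by (simp add: emeasure_eq_measure)
  note X_int = real_cond_exp_int[OF int_A, folded X_def]
  have X_100: "X (T 1 0 0 x) = X x" if "x \<in> space M" for x
    using that by (intro invariant_algebra_measurable_invariant[OF TD(4)]) (simp_all add: X_def)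
  have A_iff: "T 0 j 0 x \<in> A \<longleftrightarrow> x \<in> A" "T 0 0 j x \<in> A \<longleftrightarrow> x \<in> A" if "x \<in> space M" for j x
    using mp_Z3_action_invariant(2,3)[OF T that, of "\<lambda>x. x \<in> A"] A
    by (simp_all add: invariant_sets_iff)
  have inv: "AE x in M. X (T i j k x) = X x" for i j k
  proof -
    \<comment> \<open>\<open>T 0 j k\<close> is \<open>T 0 j 0\<close> after \<open>T 0 0 k\<close>,
      and each factor preserves membership in \<open>A\<close>.\<close>
    have "T 0 j k x \<in> A \<longleftrightarrow> x \<in> A" if "x \<in> space M" for x
      using A_iff(1)[OF TD(5)[OF that], of j 0 0 k] A_iff(2)[OF that, of k] that
      by (simp add: TD(2))
    then have "A \<in> invariant_sets M (T 0 j k)"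
      using A_sets by (simp add: invariant_sets_iff)
    then have "AE x in M. X (T 0 j k x) = X x"
      unfolding X_def by (intro AE_real_cond_exp_commuting[OF TD(4) TD(1)]) (simp_all add: TD(2))
    \<comment> \<open>The remaining factor \<open>T i 0 0\<close> leaves \<open>X\<close> unchanged
      at every point.\<close>
    moreover have "X (T i j k x) = X (T 0 j k x)" if "x \<in> space M" for x
      using mp_Z3_action_invariant(1)[OF T TD(5)[OF that], of X i 0 j k] X_100 that
      by (simp add: TD(2))
    ultimately show ?thesis
      by (auto elim!: AE_mp intro!: AE_I2)
  qed
  have "expectation X = prob A"
    using X_int(2) A_sets by simp
  then have const: "AE x in M. X x = prob A"
    using ergodic_AE_constant[OF erg X_int(1) inv] by simp
  have "D \<in> sets ?F"
    using D by (simp add: sets_invariant_algebra[OF TD(4)])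
  have "prob (A \<inter> D) = (\<integral>x\<in>D. indicator A x \<partial>M)"
    using A_sets D_sets
    by (simp add: set_lebesgue_integral_def indicator_inter_arith[symmetric] Int_commute)
  also have "\<dots> = (\<integral>x\<in>D. X x \<partial>M)"
    unfolding X_def by (rule real_cond_exp_intA[OF int_A \<open>D \<in> sets ?F\<close>])
  also have "\<dots> = (\<integral>x. indicator D x * prob A \<partial>M)"
    unfolding set_lebesgue_integral_def
    using const D_sets X_int(1) by (intro integral_cong_AE) auto
  also have "\<dots> = prob A * prob D"
    using D_sets by simp
  finally show ?thesis .
qed

text \<open>Exchanging the first two coordinates lets \<open>prob_Int_invariant_sets\<close> also
  separate \<open>J2\<close> from \<open>I2\<close>.\<close>

lemma ergodic_Z3_action_swap:
  assumes "ergodic_Z3_action M T"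
  shows "ergodic_Z3_action M (\<lambda>i j k. T j i k)"
  using assms unfolding ergodic_Z3_action_def mp_Z3_action_def by blast

theorem proposition1:
  fixes M :: "'a measure"
    and T :: "int \<Rightarrow> int \<Rightarrow> int \<Rightarrow> 'a \<Rightarrow> 'a"
    and I1 I2 I3 J1 J2 J3 :: "'a set set"
  assumes "prob_space M"
    and "ergodic_Z3_action M T"
    and "I1 = invariant_sets M (T 1 0 0)"
    and "I2 = invariant_sets M (T 0 1 0)"
    and "I3 = invariant_sets M (T 0 0 1)"
    and "J1 = I2 \<inter> I3"
    and "J2 = I1 \<inter> I3"
    and "J3 = I1 \<inter> I2"
  shows "prob_space.indep_sets M
           (\<lambda>l::nat. if l = 1 then J1 else if l = 2 then J2 else J3) {1, 2, 3}"
proof -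
  interpret prob_space M by fact
  have J1: "prob (A \<inter> D) = prob A * prob D" if "A \<in> J1" "D \<in> I1" for A D
    using prob_Int_invariant_sets[OF assms(2)] that assms(3-) by blast
  have J2: "prob (B \<inter> D) = prob B * prob D" if "B \<in> J2" "D \<in> I2" for B D
    using prob_Int_invariant_sets[OF ergodic_Z3_action_swap[OF assms(2)]] that assms(3-) by blast
  have Int: "B \<inter> C \<in> I1" if "B \<in> J2" "C \<in> J3" for B C
    using that unfolding assms(3-) by (auto simp: invariant_sets_iff)
  let ?J = "\<lambda>l::nat. if l = 1 then J1 else if l = 2 then J2 else J3"
  show ?thesis
  proof (rule indep_setsI)
    show "?J i \<subseteq> events" for i
      unfolding assms(3-) by (auto simp: invariant_sets_iff)
  next
    fix A :: "nat \<Rightarrow> 'a set" and K :: "nat set"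
    assume "K \<noteq> {}" "K \<subseteq> {1, 2, 3}" "finite K" and A: "\<forall>j\<in>K. A j \<in> ?J j"
    \<comment> \<open>In this form simplification can enumerate the seven possible index
      sets.\<close>
    then have "K \<in> Pow {1, 2, 3} - {{}}"
      by auto
    moreover have "A 1 \<in> J1" if "1 \<in> K"
      using A that by auto
    moreover have "A 2 \<in> J2" if "2 \<in> K"
      using A that by auto
    moreover have "A 3 \<in> J3" if "3 \<in> K"
      using A that by auto
    \<comment> \<open>The inclusions settle the three pairs. For the triple, \<open>J1\<close> is
      split off from the intersection of the other two events, which lies in \<open>I1\<close>, and
      then \<open>J2\<close> from \<open>J3\<close>.\<close>
    moreover have "J2 \<subseteq> I1" "J3 \<subseteq> I1" "J3 \<subseteq> I2"
      using assms(3-) by auto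
    ultimately show "prob (\<Inter>j\<in>K. A j) = (\<Prod>j\<in>K. prob (A j))"
      by (auto simp: Pow_insert J1 J2 Int subsetD)
  qed
qed

end
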